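(* Let $A$ be a finite alphabet, $X=\{x_1,x_2,x_3,\ldots\}$ a countable set of variables disjoint from $A$, and $G$ a finite group acting on $A$ from the right. Then $\mathbf{DRam}^{\mathrm{op}}\equiv_T\mathbf{GR}(A,X,G)$.
   Context: Graham-Rothschild categories. Here $\mathbb{N}=\{1,2,\ldots\}$. Let $A$ be a finite (possibly empty) alphabet, $X=\{x_1,x_2,\ldots\}$ a countably infinite set of variables disjoint from $A$, and $G$ a finite group with neutral element $e$ acting on $A$ from the right, the action being written $a^g$. For $m,n\in\mathbb{N}$, an $m$-parameter $G$-decorated $n$-letter word over $A$ is a map $w:\{1,\ldots,n\}\to(A\cup\{x_1,\ldots,x_m\})\times G$ such that: (i) if $w(i)=(a,g)$ with $a\in A$ then $g=e$; (ii) for each $\ell\in\{1,\ldots,m\}$ there are $i$ and $g\in G$ with $w(i)=(x_\ell,g)$; (iii) for each $\ell\in\{1,\ldots,m\}$, if $i=\min(w^{-1}(\{x_\ell\}\times G))$ then $w(i)=(x_\ell,e)$; (iv) if $k<\ell$ then $\min(w^{-1}(\{x_k\}\times G))<\min(w^{-1}(\{x_\ell\}\times G))$. A pair $(y,g)$ is written $y^g$. $W^n_m(A,G)$ is the set of all such words. For $u\in W^n_m(A,G)$ and $v=v_1^{g_1}\ldots v_m^{g_m}\in W^m_k(A,G)$, $u\cdot v\in W^n_k(A,G)$ is obtained by simultaneously replacing each occurrence of $x_i$ in $u$ by $v_i^{g_i}$, $i=1,\ldots,m$, and then replacing $(x_\ell^g)^h$ by $x_\ell^{gh}$ and $a^g$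 by the letter resulting from the action of $g$ on $a\in A$. The category $\mathbf{GR}(A,X,G)$ has objects the positive integers, $\hom(k,n)=W^n_k(A,G)$ if $k\le n$ and $\hom(k,n)=\varnothing$ if $k>n$, the composition of $u\in\hom(m,n)=W^n_m(A,G)$ with $v=v_1^{g_1}\ldots v_m^{g_m}\in\hom(k,m)=W^m_k(A,G)$ being the word $u\cdot v\in W^n_k(A,G)=\hom(k,n)$ obtained by substituting $v_i^{g_i}$ for every occurrence of $x_i$ in $u$ (simultaneously for $i=1,\ldots,m$) and then replacing $(x_\ell^g)^h$ by $x_\ell^{gh}$ and $a^g$ by the letter resulting from the action of $g$ on $a\in A$, and $\mathrm{id}_n=x_1x_2\ldots x_n$. A finite chain is a finite nonempty linearly ordered set. A surjective function $f:A\to B$ between finite chains is a rigid surjection if $\min f^{-1}(b)<\min f^{-1}(b')$ whenever $b<b'$ in $B$. $\mathbf{DRam}$ is the category whose objects are finite chains and whose morphisms are rigid surjections; $\mathbf{DRam}^{\mathrm{op}}$ is its opposite category. Pre-adjunction: for locally small categories $\mathbf{B}$ and $\mathbf{C}$, a pair of maps $F:\mathrm{Ob}(\mathbf{B})\to\mathrm{Ob}(\mathbf{C})$, $H:\mathrm{Ob}(\mathbf{C})\to\mathrm{Ob}(\mathbf{B})$ (not required to be functorial) is a pre-adjunction from $\mathbf{B}$ to $\mathbf{C}$ if there is a family of maps $\Phi_{X,Y}:\hom_{\mathbf{C}}(F(X),Y)\to\hom_{\mathbf{B}}(X,H(Y))$ indexed by pairs $(X,Y)\in\mathrm{Ob}(\mathbf{B})\times\mathrm{Ob}(\mathbf{C})$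 such that: (PA) for every $C\in\mathrm{Ob}(\mathbf{C})$, all $A,B\in\mathrm{Ob}(\mathbf{B})$, every $u\in\hom_{\mathbf{C}}(F(B),C)$ and every $f\in\hom_{\mathbf{B}}(A,B)$ there is a $v\in\hom_{\mathbf{C}}(F(A),F(B))$ with $\Phi_{B,C}(u)\cdot f=\Phi_{A,C}(u\cdot v)$. Here $f\cdot g$ means first $g$, then $f$. $\mathbf{B}\le_T\mathbf{C}$ means there is a pre-adjunction from $\mathbf{B}$ to $\mathbf{C}$; $\mathbf{B}\equiv_T\mathbf{C}$ means $\mathbf{B}\le_T\mathbf{C}$ and $\mathbf{C}\le_T\mathbf{B}$. *)

theory Defs
  imports "HOL-Algebra.Group"
begin

section \<open>Categories and pre-adjunctions\<close>

text \<open>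
  Composition is indexed by objects, so that the hom-sets of different pairs of objects
  need not be disjoint; \<open>Comp C X Y Z g f\<close> is \<open>g \<cdot> f\<close> (first \<open>f : X \<rightarrow> Y\<close>, then \<open>g : Y \<rightarrow> Z\<close>).
\<close>

record ('o, 'm) cat =
  Ob :: "'o set"
  Hom :: "'o \<Rightarrow> 'o \<Rightarrow> 'm set"
  Comp :: "'o \<Rightarrow> 'o \<Rightarrow> 'o \<Rightarrow> 'm \<Rightarrow> 'm \<Rightarrow> 'm"
  Ident :: "'o \<Rightarrow> 'm"

locale category =
  fixes C :: "('o, 'm) cat"
  assumes comp_closed:
      "\<lbrakk>X \<in> Ob C; Y \<in> Ob C; Z \<in> Ob C; f \<in> Hom C X Y; g \<in> Hom C Y Z\<rbrakk>
        \<Longrightarrow> Comp C X Y Z g f \<in> Hom C X Z"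
    and ident_closed: "X \<in> Ob C \<Longrightarrow> Ident C X \<in> Hom C X X"
    and comp_ident_right:
      "\<lbrakk>X \<in> Ob C; Y \<in> Ob C; f \<in> Hom C X Y\<rbrakk> \<Longrightarrow> Comp C X X Y f (Ident C X) = f"
    and comp_ident_left:
      "\<lbrakk>X \<in> Ob C; Y \<in> Ob C; f \<in> Hom C X Y\<rbrakk> \<Longrightarrow> Comp C X Y Y (Ident C Y) f = f"
    and comp_assoc:
      "\<lbrakk>W \<in> Ob C; X \<in> Ob C; Y \<in> Ob C; Z \<in> Ob C;
        f \<in> Hom C W X; g \<in> Hom C X Y; h \<in> Hom C Y Z\<rbrakk>
        \<Longrightarrow> Comp C W X Z (Comp C X Y Z h g) f = Comp C W Y Z h (Comp C W X Y g f)"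

definition Op :: "('o, 'm) cat \<Rightarrow> ('o, 'm) cat" where
  "Op C = \<lparr>Ob = Ob C,
           Hom = (\<lambda>X Y. Hom C Y X),
           Comp = (\<lambda>X Y Z g f. Comp C Z Y X f g),
           Ident = Ident C\<rparr>"

lemma category_Op:
  assumes "category C"
  shows "category (Op C)"
proof -
  interpret category C by fact
  show ?thesis
    by unfold_locales
      (simp_all add: Op_def comp_closed ident_closed comp_ident_left comp_ident_right comp_assoc)
qed

locale pre_adjunction = B: category B + C: category C
  for B :: "('o1, 'm1) cat" and C :: "('o2, 'm2) cat" +
  fixes F :: "'o1 \<Rightarrow> 'o2" and H :: "'o2 \<Rightarrow> 'o1"
  assumes F_Ob: "F \<in> Ob B \<rightarrow> Ob C"
    and H_Ob: "H \<in> Ob C \<rightarrow> Ob B"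
    and PA: "\<exists>\<Phi>. (\<forall>X\<in>Ob B. \<forall>Y\<in>Ob C. \<Phi> X Y \<in> Hom C (F X) Y \<rightarrow> Hom B X (H Y)) \<and>
      (\<forall>Z\<in>Ob C. \<forall>X\<in>Ob B. \<forall>Y\<in>Ob B. \<forall>u\<in>Hom C (F Y) Z. \<forall>f\<in>Hom B X Y.
        \<exists>v\<in>Hom C (F X) (F Y).
          Comp B X Y (H Z) (\<Phi> Y Z u) f = \<Phi> X Z (Comp C (F X) (F Y) Z u v))"

definition tukey_le :: "('o1, 'm1) cat \<Rightarrow> ('o2, 'm2) cat \<Rightarrow> bool"  (infix "\<preceq>\<^sub>T" 50) where
  "B \<preceq>\<^sub>T C \<longleftrightarrow> (\<exists>F H. pre_adjunction B C F H)"

definition tukey_equiv :: "('o1, 'm1) cat \<Rightarrow> ('o2, 'm2) cat \<Rightarrow> bool"  (infix "\<equiv>\<^sub>T" 50) where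
  "B \<equiv>\<^sub>T C \<longleftrightarrow> B \<preceq>\<^sub>T C \<and> C \<preceq>\<^sub>T B"


section \<open>Finite chains and rigid surjections\<close>

text \<open>
  A chain is a carrier with its reflexive order relation. The elements of chains are taken from
  a type \<open>'c\<close>; only for infinite \<open>'c\<close> do chains of all finite sizes exist.
\<close>

type_synonym 'c chain = "'c set \<times> 'c rel"

definition finite_chains :: "'c chain set" where
  "finite_chains = {(S, r). finite S \<and> S \<noteq> {} \<and> linear_order_on S r}"

text \<open>
  \<^term>\<open>wo_rel.minim r S\<close> is the library's least element of \<open>S\<close> with respect to \<open>r\<close>.
  Functions are made undefined outside their domain, so that equality of morphisms is
  equality of functions on the chain.
\<close>

definition rigid_surjections :: "'c chain \<Rightarrow> 'c chain \<Rightarrow> ('c \<Rightarrow> 'c) set" where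
  "rigid_surjections P Q = (case P of (S, r) \<Rightarrow> case Q of (T, q) \<Rightarrow>
     {f \<in> S \<rightarrow>\<^sub>E T. f ` S = T \<and>
       (\<forall>b\<in>T. \<forall>b'\<in>T. (b, b') \<in> q \<and> b \<noteq> b' \<longrightarrow>
         (wo_rel.minim r {i \<in> S. f i = b}, wo_rel.minim r {i \<in> S. f i = b'}) \<in> r \<and>
          wo_rel.minim r {i \<in> S. f i = b} \<noteq> wo_rel.minim r {i \<in> S. f i = b'})})"

definition DRam :: "('c chain, 'c \<Rightarrow> 'c) cat" where
  "DRam = \<lparr>Ob = finite_chains,
           Hom = rigid_surjections,
           Comp = (\<lambda>P Q R g f. compose (fst P) g f),
           Ident = (\<lambda>P. \<lambda>i\<in>fst P. i)\<rparr>"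


section \<open>Graham--Rothschild categories\<close>

definition right_action :: "('g, 'z) monoid_scheme \<Rightarrow> 'a set \<Rightarrow> ('a \<Rightarrow> 'g \<Rightarrow> 'a) \<Rightarrow> bool" where
  "right_action G A act \<longleftrightarrow>
     (\<forall>a\<in>A. \<forall>g\<in>carrier G. act a g \<in> A) \<and>
     (\<forall>a\<in>A. act a \<one>\<^bsub>G\<^esub> = a) \<and>
     (\<forall>a\<in>A. \<forall>g\<in>carrier G. \<forall>h\<in>carrier G. act (act a g) h = act a (g \<otimes>\<^bsub>G\<^esub> h))"

text \<open>
  Letters and variables live in a common type \<open>'a\<close>; the variables are \<open>x 1, x 2, \<dots>\<close>
  (the value \<open>x 0\<close> is irrelevant).
\<close>

definition variables :: "(nat \<Rightarrow> 'a) \<Rightarrow> 'a set \<Rightarrow> bool" where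
  "variables x A \<longleftrightarrow> inj_on x {1..} \<and> x ` {1..} \<inter> A = {}"

definition occs :: "('g, 'z) monoid_scheme \<Rightarrow> nat \<Rightarrow> (nat \<Rightarrow> 'a \<times> 'g) \<Rightarrow> 'a \<Rightarrow> nat set" where
  "occs G n w y = {i \<in> {1..n}. w i \<in> {y} \<times> carrier G}"

definition words ::
  "'a set \<Rightarrow> (nat \<Rightarrow> 'a) \<Rightarrow> ('g, 'z) monoid_scheme \<Rightarrow> nat \<Rightarrow> nat \<Rightarrow> (nat \<Rightarrow> 'a \<times> 'g) set" where
  "words A x G n m = {w \<in> {1..n} \<rightarrow>\<^sub>E (A \<union> x ` {1..m}) \<times> carrier G.
     (\<forall>i\<in>{1..n}. fst (w i) \<in> A \<longrightarrow> snd (w i) = \<one>\<^bsub>G\<^esub>) \<and>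
     (\<forall>l\<in>{1..m}. \<exists>i\<in>{1..n}. \<exists>g\<in>carrier G. w i = (x l, g)) \<and>
     (\<forall>l\<in>{1..m}. w (Min (occs G n w (x l))) = (x l, \<one>\<^bsub>G\<^esub>)) \<and>
     (\<forall>k\<in>{1..m}. \<forall>l\<in>{1..m}. k < l \<longrightarrow> Min (occs G n w (x k)) < Min (occs G n w (x l)))}"

text \<open>The reduction of \<open>(y\<^sup>g)\<^sup>h\<close> to a single decorated symbol.\<close>

definition decorate ::
  "'a set \<Rightarrow> ('g, 'z) monoid_scheme \<Rightarrow> ('a \<Rightarrow> 'g \<Rightarrow> 'a) \<Rightarrow> 'a \<times> 'g \<Rightarrow> 'g \<Rightarrow> 'a \<times> 'g" where
  "decorate A G act p h = (case p of (y, g) \<Rightarrow>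
     if y \<in> A then (act y h, \<one>\<^bsub>G\<^esub>) else (y, g \<otimes>\<^bsub>G\<^esub> h))"

definition subst_word ::
  "'a set \<Rightarrow> (nat \<Rightarrow> 'a) \<Rightarrow> ('g, 'z) monoid_scheme \<Rightarrow> ('a \<Rightarrow> 'g \<Rightarrow> 'a) \<Rightarrow> nat \<Rightarrow>
    (nat \<Rightarrow> 'a \<times> 'g) \<Rightarrow> (nat \<Rightarrow> 'a \<times> 'g) \<Rightarrow> nat \<Rightarrow> 'a \<times> 'g" where
  "subst_word A x G act n u v = (\<lambda>i\<in>{1..n}. case u i of (y, h) \<Rightarrow>
     if y \<in> A then (y, h) else decorate A G act (v (inv_into {1..} x y)) h)"

definition GR ::
  "'a set \<Rightarrow> (nat \<Rightarrow> 'a) \<Rightarrow> ('g, 'z) monoid_scheme \<Rightarrow> ('a \<Rightarrow> 'g \<Rightarrow> 'a) \<Rightarrow>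
    (nat, nat \<Rightarrow> 'a \<times> 'g) cat" where
  "GR A x G act = \<lparr>Ob = {1..},
     Hom = (\<lambda>k n. if k \<le> n then words A x G n k else {}),
     Comp = (\<lambda>k m n u v. subst_word A x G act n u v),
     Ident = (\<lambda>n. \<lambda>i\<in>{1..n}. (x i, \<one>\<^bsub>G\<^esub>))\<rparr>"


section \<open>The examples are categories\<close>

lemma finite_linear_order_wo_rel:
  assumes "finite S" "linear_order_on S r"
  shows "wo_rel r"
proof -
  have F: "Field r = S"
    using assms(2) by (auto simp: order_on_defs refl_on_def Field_def)
  have "finite r"
    using assms by (auto simp: order_on_defs intro: finite_subset)
  moreover have "acyclic (r - Id)"
  proof -
    have "trans (r - Id)" "irrefl (r - Id)"
      using assms(2) by (auto simp: order_on_defs trans_def antisym_def irrefl_def)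
    then show ?thesis
      by (simp add: acyclic_irrefl)
  qed
  ultimately have "wf (r - Id)"
    by (simp add: finite_acyclic_wf)
  with assms F show ?thesis
    by (simp add: wo_rel_def well_order_on_def)
qed

lemma chain_minim:
  assumes "finite S" "linear_order_on S r" "T \<subseteq> S" "T \<noteq> {}"
  shows "wo_rel.minim r T \<in> T" "\<And>t. t \<in> T \<Longrightarrow> (wo_rel.minim r T, t) \<in> r"
proof -
  interpret wo_rel r using assms finite_linear_order_wo_rel by blast
  have "Field r = S"
    using assms(2) by (auto simp: order_on_defs refl_on_def Field_def)
  then show "minim T \<in> T" "\<And>t. t \<in> T \<Longrightarrow> (minim T, t) \<in> r"
    using assms minim_in minim_least by auto
qed

lemma chain_minim_eqI:
  assumes "finite S" "linear_order_on S r" "T \<subseteq> S" "a \<in> T" "\<And>t. t \<in> T \<Longrightarrow> (a, t) \<in> r"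
  shows "wo_rel.minim r T = a"
proof -
  have "wo_rel.minim r T \<in> T" "(wo_rel.minim r T, a) \<in> r"
    using chain_minim[OF assms(1-3)] assms(4) by auto
  with assms show ?thesis
    by (auto simp: order_on_defs antisym_def)
qed

lemma rigid_surjections_minim_comp:
  assumes P: "(S, r) \<in> finite_chains" and Q: "(T, q) \<in> finite_chains"
    and f: "f \<in> rigid_surjections (S, r) (T, q)"
    and g: "g \<in> T \<rightarrow> U" "c \<in> g ` T"
  shows "wo_rel.minim r {i \<in> S. g (f i) = c}
       = wo_rel.minim r {i \<in> S. f i = wo_rel.minim q {j \<in> T. g j = c}}"
proof -
  define b where "b = wo_rel.minim q {j \<in> T. g j = c}"
  define a where "a = wo_rel.minim r {i \<in> S. f i = b}"
  from P Q have S: "finite S" "linear_order_on S r" and T: "finite T" "linear_order_on T q"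
    by (auto simp: finite_chains_def)
  have fE: "f \<in> S \<rightarrow>\<^sub>E T" "f ` S = T"
    and mono: "\<And>b b'. \<lbrakk>b \<in> T; b' \<in> T; (b, b') \<in> q; b \<noteq> b'\<rbrakk> \<Longrightarrow>
      (wo_rel.minim r {i \<in> S. f i = b}, wo_rel.minim r {i \<in> S. f i = b'}) \<in> r"
    using f by (auto simp: rigid_surjections_def)
  have "{j \<in> T. g j = c} \<noteq> {}"
    using g by auto
  note b = chain_minim[OF T _ this, folded b_def, simplified]
  have fib: "{i \<in> S. f i = b'} \<noteq> {}" if "b' \<in> T" for b'
    using fE that by auto
  note a = chain_minim[OF S _ fib, of b, folded a_def, simplified]
  have trans: "trans r"
    using S by (simp add: order_on_defs)
  have "wo_rel.minim r {i \<in> S. g (f i) = c} = a"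
  proof (rule chain_minim_eqI[OF S])
    show "a \<in> {i \<in> S. g (f i) = c}"
      using a b by auto
    fix t assume "t \<in> {i \<in> S. g (f i) = c}"
    then have t: "t \<in> S" "g (f t) = c" "f t \<in> T"
      using fE by auto
    have "(wo_rel.minim r {i \<in> S. f i = f t}, t) \<in> r"
      using chain_minim(2)[OF S, of "{i \<in> S. f i = f t}" t] t by auto
    moreover have "(a, wo_rel.minim r {i \<in> S. f i = f t}) \<in> r" if "b \<noteq> f t"
      unfolding a_def using mono b t that by auto
    ultimately show "(a, t) \<in> r"
      using trans by (cases "b = f t") (auto simp: a_def dest: transD)
  qed auto
  then show ?thesis
    by (simp add: a_def b_def)
qed

lemma category_DRam: "category DRam"
proof
  fix P Q R :: "'c chain" and f g
  assume ob: "P \<in> Ob DRam" "Q \<in> Ob DRam" "R \<in> Ob DRam"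
    and f: "f \<in> Hom DRam P Q" and g: "g \<in> Hom DRam Q R"
  obtain S r T q U p where PQR: "P = (S, r)" "Q = (T, q)" "R = (U, p)"
    by (metis surj_pair)
  have f': "f \<in> S \<rightarrow>\<^sub>E T" "f ` S = T"
    and f'': "\<And>b b'. \<lbrakk>b \<in> T; b' \<in> T; (b, b') \<in> q; b \<noteq> b'\<rbrakk> \<Longrightarrow>
      (wo_rel.minim r {i \<in> S. f i = b}, wo_rel.minim r {i \<in> S. f i = b'}) \<in> r \<and>
      wo_rel.minim r {i \<in> S. f i = b} \<noteq> wo_rel.minim r {i \<in> S. f i = b'}"
    using f PQR by (auto simp: DRam_def rigid_surjections_def)
  have g': "g \<in> T \<rightarrow>\<^sub>E U" "g ` T = U"
    and g'': "\<And>b b'. \<lbrakk>b \<in> U; b' \<in> U; (b, b') \<in> p; b \<noteq> b'\<rbrakk> \<Longrightarrow>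
      (wo_rel.minim q {i \<in> T. g i = b}, wo_rel.minim q {i \<in> T. g i = b'}) \<in> q \<and>
      wo_rel.minim q {i \<in> T. g i = b} \<noteq> wo_rel.minim q {i \<in> T. g i = b'}"
    using g PQR by (auto simp: DRam_def rigid_surjections_def)
  have T: "finite T" "linear_order_on T q"
    using ob PQR by (auto simp: DRam_def finite_chains_def)
  have minim: "wo_rel.minim r {i \<in> S. compose S g f i = c}
      = wo_rel.minim r {i \<in> S. f i = wo_rel.minim q {j \<in> T. g j = c}}" if "c \<in> U" for c
  proof -
    have "{i \<in> S. compose S g f i = c} = {i \<in> S. g (f i) = c}"
      by (auto simp: compose_def)
    then show ?thesis
      using rigid_surjections_minim_comp[of S r T q f g U c] ob f g' that PQR
      by (auto simp: DRam_def)
  qed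
  have mem: "wo_rel.minim q {j \<in> T. g j = c} \<in> T" if "c \<in> U" for c
    using chain_minim(1)[OF T, of "{j \<in> T. g j = c}"] that g' by auto
  have "compose S g f \<in> S \<rightarrow>\<^sub>E U"
    using f' g' by (auto simp: compose_def)
  moreover have "compose S g f ` S = U"
    using f'(2) g'(2) by (simp add: compose_def image_comp [symmetric] image_image [of g f S, symmetric])
  moreover have "(wo_rel.minim r {i \<in> S. compose S g f i = c},
        wo_rel.minim r {i \<in> S. compose S g f i = c'}) \<in> r \<and>
      wo_rel.minim r {i \<in> S. compose S g f i = c} \<noteq>
        wo_rel.minim r {i \<in> S. compose S g f i = c'}"
    if "c \<in> U" "c' \<in> U" "(c, c') \<in> p" "c \<noteq> c'" for c c'
    unfolding minim[OF that(1)] minim[OF that(2)]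
    using f''[OF mem[OF that(1)] mem[OF that(2)]] g''[OF that] by blast
  ultimately show "Comp DRam P Q R g f \<in> Hom DRam P R"
    unfolding PQR by (simp add: DRam_def rigid_surjections_def)
next
  fix P :: "'c chain" assume P: "P \<in> Ob DRam"
  obtain S r where [simp]: "P = (S, r)" by fastforce
  have "wo_rel.minim r {i \<in> S. (\<lambda>i\<in>S. i) i = b} = b" if "b \<in> S" for b
    using P that
    by (intro chain_minim_eqI[of S])
      (auto simp: DRam_def finite_chains_def order_on_defs refl_on_def)
  then show "Ident DRam P \<in> Hom DRam P P"
    by (auto simp: DRam_def rigid_surjections_def)
next
  fix P Q :: "'c chain" and f assume "f \<in> Hom DRam P Q"
  then have "f \<in> fst P \<rightarrow>\<^sub>E fst Q"
    by (auto simp: DRam_def rigid_surjections_def split: prod.splits)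
  then show "Comp DRam P P Q f (Ident DRam P) = f" "Comp DRam P Q Q (Ident DRam Q) f = f"
    by (auto simp: DRam_def compose_def fun_eq_iff PiE_def extensional_def)
next
  fix O' P Q R :: "'c chain" and f g h assume "f \<in> Hom DRam O' P"
  then have "f \<in> fst O' \<rightarrow> fst P"
    by (auto simp: DRam_def rigid_surjections_def split: prod.splits)
  then show "Comp DRam O' P R (Comp DRam P Q R h g) f = Comp DRam O' Q R h (Comp DRam O' P Q g f)"
    by (auto simp: DRam_def compose_def fun_eq_iff)
qed

locale GR_setting = group G
  for A :: "'a set" and x :: "nat \<Rightarrow> 'a" and G :: "('g, 'z) monoid_scheme" (structure)
    and act :: "'a \<Rightarrow> 'g \<Rightarrow> 'a" +
  assumes vars: "variables x A" and action: "right_action G A act"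
begin

lemma x_inj [simp]: "1 \<le> k \<Longrightarrow> 1 \<le> l \<Longrightarrow> x k = x l \<longleftrightarrow> k = l"
  using vars by (auto simp: variables_def inj_on_def)

lemma x_notin [simp]: "1 \<le> k \<Longrightarrow> x k \<notin> A"
  using vars by (auto simp: variables_def)

lemma x_index [simp]:
  "1 \<le> k \<Longrightarrow> inv_into {1..} x (x k) = k"
  "1 \<le> k \<Longrightarrow> inv_into {Suc 0..} x (x k) = k"
  using vars by (auto simp: variables_def intro: inv_into_f_f)

lemma act_simps [simp]:
  "a \<in> A \<Longrightarrow> g \<in> carrier G \<Longrightarrow> act a g \<in> A"
  "a \<in> A \<Longrightarrow> act a \<one> = a"
  "a \<in> A \<Longrightarrow> g \<in> carrier G \<Longrightarrow> h \<in> carrier G \<Longrightarrow> act (act a g) h = act a (g \<otimes> h)"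
  using action by (auto simp: right_action_def)

lemma finite_occs [simp]: "finite (occs G n w y)"
  by (simp add: occs_def)

lemma words_cases:
  assumes "w \<in> words A x G n m" "i \<in> {1..n}"
  obtains (letter) a where "a \<in> A" "w i = (a, \<one>)"
  | (var) l g where "l \<in> {1..m}" "g \<in> carrier G" "w i = (x l, g)"
proof -
  have "w i \<in> (A \<union> x ` {1..m}) \<times> carrier G" "fst (w i) \<in> A \<longrightarrow> snd (w i) = \<one>"
    using assms unfolding words_def by blast+
  then show ?thesis
    using that by (cases "w i") auto
qed

lemma words_first:
  assumes "w \<in> words A x G n m" "l \<in> {1..m}"
  shows "Min (occs G n w (x l)) \<in> {1..n}"
    "w (Min (occs G n w (x l))) = (x l, \<one>)"
    "\<And>i g. \<lbrakk>i \<in> {1..n}; w i = (x l, g)\<rbrakk> \<Longrightarrow> Min (occs G n w (x l)) \<le> i"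
proof -
  have "\<forall>l\<in>{1..m}. \<exists>i\<in>{1..n}. \<exists>g\<in>carrier G. w i = (x l, g)"
    using assms(1) by (simp add: words_def)
  with assms(2) obtain j h where "j \<in> {1..n}" "h \<in> carrier G" "w j = (x l, h)"
    by blast
  then have "j \<in> occs G n w (x l)"
    by (simp add: occs_def)
  then have "occs G n w (x l) \<noteq> {}"
    by blast
  then have "Min (occs G n w (x l)) \<in> occs G n w (x l)"
    by (rule Min_in [OF finite_occs])
  moreover have "occs G n w (x l) \<subseteq> {1..n}"
    by (auto simp: occs_def)
  ultimately show "Min (occs G n w (x l)) \<in> {1..n}"
    by blast
  have "\<forall>l\<in>{1..m}. w (Min (occs G n w (x l))) = (x l, \<one>)"
    using assms(1) by (simp add: words_def)
  then show "w (Min (occs G n w (x l))) = (x l, \<one>)"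
    using assms(2) by (rule bspec)
  fix i g assume i: "i \<in> {1..n}" "w i = (x l, g)"
  have "g \<in> carrier G"
    using assms(1) i(1)
  proof (cases rule: words_cases)
    case (letter a)
    with i(2) show ?thesis by auto
  next
    case (var l' g')
    with i(2) show ?thesis by simp
  qed
  with i have "i \<in> occs G n w (x l)"
    by (simp add: occs_def)
  then show "Min (occs G n w (x l)) \<le> i"
    using finite_occs by (rule Min_le [rotated])
qed

lemma words_mono:
  assumes "w \<in> words A x G n m" "k \<in> {1..m}" "l \<in> {1..m}" "k < l"
  shows "Min (occs G n w (x k)) < Min (occs G n w (x l))"
  using assms by (auto simp: words_def)

lemma wordsI:
  assumes "w \<in> extensional {1..n}"
    and "\<And>i. i \<in> {1..n} \<Longrightarrow> (\<exists>a\<in>A. w i = (a, \<one>)) \<or> (\<exists>l\<in>{1..m}. \<exists>g\<in>carrier G. w i = (x l, g))"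
    and "\<And>l. l \<in> {1..m} \<Longrightarrow> p l \<in> {1..n} \<and> w (p l) = (x l, \<one>)"
    and "\<And>l i g. \<lbrakk>l \<in> {1..m}; i \<in> {1..n}; w i = (x l, g)\<rbrakk> \<Longrightarrow> p l \<le> i"
    and "\<And>k l. \<lbrakk>k \<in> {1..m}; l \<in> {1..m}; k < l\<rbrakk> \<Longrightarrow> p k < p l"
  shows "w \<in> words A x G n m" "\<And>l. l \<in> {1..m} \<Longrightarrow> Min (occs G n w (x l)) = p l"
proof -
  show Min: "Min (occs G n w (x l)) = p l" if "l \<in> {1..m}" for l
    using assms(3,4) that by (intro Min_eqI) (auto simp: occs_def)
  have "w i \<in> (A \<union> x ` {1..m}) \<times> carrier G" if "i \<in> {1..n}" for i
    using assms(2)[OF that] by auto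
  moreover have "snd (w i) = \<one>" if "i \<in> {1..n}" "fst (w i) \<in> A" for i
    using assms(2)[OF that(1)] that(2) by auto
  moreover have "\<exists>i\<in>{1..n}. \<exists>g\<in>carrier G. w i = (x l, g)" if "l \<in> {1..m}" for l
    using assms(3)[OF that] one_closed by blast
  ultimately show "w \<in> words A x G n m"
    using assms(1,3,5) Min by (auto simp: words_def PiE_def)
qed

lemma subst_word_letter:
  "i \<in> {1..n} \<Longrightarrow> u i = (a, g) \<Longrightarrow> a \<in> A \<Longrightarrow> subst_word A x G act n u v i = (a, g)"
  by (simp add: subst_word_def)

lemma subst_word_var:
  "i \<in> {1..n} \<Longrightarrow> u i = (x l, h) \<Longrightarrow> 1 \<le> l \<Longrightarrow>
    subst_word A x G act n u v i = decorate A G act (v l) h"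
  by (simp add: subst_word_def)

lemma subst_word_closed:
  assumes u: "u \<in> words A x G n m" and v: "v \<in> words A x G m k"
  shows "subst_word A x G act n u v \<in> words A x G n k"
proof -
  let ?w = "subst_word A x G act n u v"
  define pu where "pu l = Min (occs G n u (x l))" for l
  define pv where "pv l = Min (occs G m v (x l))" for l
  note u1 = words_first[OF u, folded pu_def] and u2 = words_mono[OF u, folded pu_def]
  note v1 = words_first[OF v, folded pv_def] and v2 = words_mono[OF v, folded pv_def]
  show ?thesis
  proof (rule wordsI(1))
    show "?w \<in> extensional {1..n}"
      by (simp add: subst_word_def)
    show "(\<exists>a\<in>A. ?w i = (a, \<one>)) \<or> (\<exists>l\<in>{1..k}. \<exists>g\<in>carrier G. ?w i = (x l, g))"
      if i: "i \<in> {1..n}" for i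
      using u i
    proof (cases rule: words_cases)
      case (letter a)
      then show ?thesis using subst_word_letter[OF i] by auto
    next
      case u_var: (var j h)
      with i have w: "?w i = decorate A G act (v j) h"
        by (intro subst_word_var) auto
      show ?thesis
        using v u_var(1)
      proof (cases rule: words_cases)
        case (letter a)
        then show ?thesis using w u_var by (auto simp: decorate_def)
      next
        case (var l g)
        then show ?thesis using w u_var by (auto simp: decorate_def)
      qed
    qed
    show "pu (pv l) \<in> {1..n} \<and> ?w (pu (pv l)) = (x l, \<one>)" if l: "l \<in> {1..k}" for l
    proof -
      have "?w (pu (pv l)) = decorate A G act (v (pv l)) \<one>"
        using u1 v1 l by (intro subst_word_var) auto
      then show ?thesis
        using u1 v1 l by (auto simp: decorate_def)
    qed
    show "pu (pv l) \<le> i" if l: "l \<in> {1..k}" and i: "i \<in> {1..n}" and wi: "?w i = (x l, g)" for l i g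
      using u i
    proof (cases rule: words_cases)
      case (letter a)
      then show ?thesis using subst_word_letter[OF i] wi l by auto
    next
      case u_var: (var j h)
      with i have w: "?w i = decorate A G act (v j) h"
        by (intro subst_word_var) auto
      have le: "pu j \<le> i"
        using u1(3) u_var i by blast
      show ?thesis
        using v u_var(1)
      proof (cases rule: words_cases)
        case (letter a)
        then have "x l \<in> A"
          using w wi u_var by (auto simp: decorate_def)
        then show ?thesis using l by auto
      next
        case (var l' g')
        then have "l' = l"
          using w wi l by (auto simp: decorate_def)
        then have "pv l \<le> j"
          using v1(3) var u_var by blast
        then have "pu (pv l) \<le> pu j"
          using u2[of "pv l" j] v1(1)[OF l] u_var by (cases "pv l = j") auto
        with le show ?thesis by simp
      qed
    qed
    show "pu (pv l) < pu (pv l')" if "l \<in> {1..k}" "l' \<in> {1..k}" "l < l'" for l l'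
      using that u2 v2 v1(1) by blast
  qed
qed

lemma subst_word_assoc:
  assumes u: "u \<in> words A x G n m" and v: "v \<in> words A x G m k" and w: "w \<in> words A x G k l"
  shows "subst_word A x G act n (subst_word A x G act n u v) w
       = subst_word A x G act n u (subst_word A x G act m v w)" (is "?L = ?R")
proof
  fix i
  show "?L i = ?R i"
  proof (cases "i \<in> {1..n}")
    case False
    then show ?thesis unfolding subst_word_def by (simp only: restrict_apply if_False)
  next
    case i: True
    from u i show ?thesis
    proof (cases rule: words_cases)
      case (letter a)
      then show ?thesis using i by (simp add: subst_word_def)
    next
      case u_var: (var j h)
      have L: "subst_word A x G act n u v i = decorate A G act (v j) h"
        and R: "?R i = decorate A G act (subst_word A x G act m v w j) h"
        using u_var i by (auto intro: subst_word_var)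
      show ?thesis
        using v u_var(1)
      proof (cases rule: words_cases)
        case (letter a)
        have "subst_word A x G act m v w j = (a, \<one>)"
          using letter u_var by (intro subst_word_letter) auto
        moreover have "subst_word A x G act n u v i = (act a h, \<one>)"
          using letter L by (simp add: decorate_def)
        then have "?L i = (act a h, \<one>)"
          using letter u_var i subst_word_letter by (metis act_simps(1))
        ultimately show ?thesis
          using R letter by (simp add: decorate_def)
      next
        case v_var: (var p g)
        have 1: "subst_word A x G act m v w j = decorate A G act (w p) g"
          using v_var u_var by (intro subst_word_var) auto
        have 2: "?L i = decorate A G act (w p) (g \<otimes> h)"
          using v_var i L by (intro subst_word_var) (auto simp: decorate_def)
        show ?thesis
          using w v_var(1)
          by (cases rule: words_cases) (use R 1 2 u_var v_var in \<open>auto simp: decorate_def m_assoc\<close>)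
      qed
    qed
  qed
qed

lemma category_GR: "category (GR A x G act)"
proof
  fix k m n f g
  assume "f \<in> Hom (GR A x G act) k m" "g \<in> Hom (GR A x G act) m n"
  then show "Comp (GR A x G act) k m n g f \<in> Hom (GR A x G act) k n"
    using subst_word_closed by (auto simp: GR_def split: if_splits)
next
  fix n assume "n \<in> Ob (GR A x G act)"
  have "(\<lambda>i\<in>{1..n}. (x i, \<one>)) \<in> words A x G n n"
    by (rule wordsI(1)[where p = "\<lambda>i. i"]) auto
  then show "Ident (GR A x G act) n \<in> Hom (GR A x G act) n n"
    by (simp add: GR_def)
next
  fix k n f assume "f \<in> Hom (GR A x G act) k n"
  then have f: "f \<in> words A x G n k"
    by (auto simp: GR_def split: if_splits)
  then have ext: "f i = undefined" if "i \<notin> {1..n}" for i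
    using that by (auto simp: words_def PiE_def extensional_def)
  have "subst_word A x G act n f (\<lambda>i\<in>{1..k}. (x i, \<one>)) i = f i" for i
  proof (cases "i \<in> {1..n}")
    case False
    then show ?thesis using ext[OF False] unfolding subst_word_def by (simp only: restrict_apply if_False)
  next
    case i: True
    from f i show ?thesis
      by (cases rule: words_cases) (use i in \<open>auto simp: subst_word_def decorate_def\<close>)
  qed
  then show "Comp (GR A x G act) k k n f (Ident (GR A x G act) k) = f"
    by (auto simp: GR_def)
  have "subst_word A x G act n (\<lambda>i\<in>{1..n}. (x i, \<one>)) f i = f i" for i
  proof (cases "i \<in> {1..n}")
    case False
    then show ?thesis using ext[OF False] unfolding subst_word_def by (simp only: restrict_apply if_False)
  next
    case i: True
    from f i show ?thesis
      by (cases rule: words_cases) (use i in \<open>auto simp: subst_word_def decorate_def\<close>)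
  qed
  then show "Comp (GR A x G act) k n n (Ident (GR A x G act) n) f = f"
    by (auto simp: GR_def)
next
  fix l k m n f g h
  assume "f \<in> Hom (GR A x G act) l k" "g \<in> Hom (GR A x G act) k m" "h \<in> Hom (GR A x G act) m n"
  then show "Comp (GR A x G act) l k n (Comp (GR A x G act) k m n h g) f
      = Comp (GR A x G act) l m n h (Comp (GR A x G act) l k m g f)"
    using subst_word_assoc by (auto simp: GR_def split: if_splits)
qed

end

end

theory Submission
  imports Defs
begin

text \<open>
  Both pre-adjunctions are almost functorial. A rigid surjection between chains is a word without
  letters and decorations. Conversely a word over \<open>m\<close> variables becomes a rigid surjection onto
  \<open>{1..m}\<close> by forgetting the decorations and sending all letters to the least element, which
  composition with a rigid surjection preserves. For the other direction, order the symbols by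
  \<open>A < x\<^sub>1\<^sup>e < x\<^sub>1\<^sup>g < \<dots> < x\<^sub>2\<^sup>e < \<dots>\<close>, with \<open>e\<close> first among
  the decorations: a rigid surjection onto this chain is a word when read as a sequence of
  symbols, and substitution of a fixed word is a rigid surjection from symbols to symbols.
\<close>

section \<open>Enumerating finite chains\<close>

text \<open>Chain orders are reflexive, so an element counts itself and ranks start at 1, like the
  positions and the variable indices of words.\<close>

definition rank :: "'c rel \<Rightarrow> 'c \<Rightarrow> nat" where
  "rank r a = card {b. (b, a) \<in> r}"

definition enum :: "'c chain \<Rightarrow> nat \<Rightarrow> 'c" where
  "enum P = inv_into (fst P) (rank (snd P))"

lemma rank_less:
  assumes "finite S" "linear_order_on S r" "(a, b) \<in> r" "a \<noteq> b"
  shows "rank r a < rank r b"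
  unfolding rank_def
proof (rule psubset_card_mono)
  have "{c. (c, b) \<in> r} \<subseteq> S"
    using assms(2) by (auto simp: order_on_defs)
  then show "finite {c. (c, b) \<in> r}"
    using assms(1) finite_subset by blast
  have "(b, b) \<in> r"
    using assms by (auto simp: order_on_defs refl_on_def)
  moreover have "(b, a) \<notin> r"
    using assms by (auto simp: order_on_defs antisym_def)
  moreover have "trans r"
    using assms by (simp add: order_on_defs)
  ultimately show "{c. (c, a) \<in> r} \<subset> {c. (c, b) \<in> r}"
    using assms(3) by (auto dest: transD)
qed

lemma rank_le_iff:
  assumes "finite S" "linear_order_on S r" "a \<in> S" "b \<in> S"
  shows "rank r a \<le> rank r b \<longleftrightarrow> (a, b) \<in> r"
proof (cases "a = b")
  case True
  then show ?thesis
    using assms by (auto simp: order_on_defs refl_on_def)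
next
  case False
  then have "(a, b) \<in> r \<or> (b, a) \<in> r" "\<not> ((a, b) \<in> r \<and> (b, a) \<in> r)"
    using assms by (auto simp: order_on_defs total_on_def antisym_def)
  then show ?thesis
    using rank_less[OF assms(1,2)] False by (metis leD less_imp_le)
qed

lemma bij_betw_rank:
  assumes S: "finite S" "linear_order_on S r"
  shows "bij_betw (rank r) S {1..card S}"
proof -
  have inj: "inj_on (rank r) S"
  proof (rule inj_onI)
    fix a b assume "a \<in> S" "b \<in> S" "rank r a = rank r b"
    then have "(a, b) \<in> r" "(b, a) \<in> r"
      using rank_le_iff[OF S] by (metis order_refl)+
    then show "a = b"
      using S by (auto simp: order_on_defs antisym_def)
  qed
  have "rank r a \<in> {1..card S}" if "a \<in> S" for a
  proof -
    have "{b. (b, a) \<in> r} \<subseteq> S" "a \<in> {b. (b, a) \<in> r}"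
      using S that by (auto simp: order_on_defs refl_on_def)
    then show ?thesis
      unfolding rank_def using S(1)
      by (metis Suc_le_eq One_nat_def atLeastAtMost_iff card_gt_0_iff card_mono empty_iff finite_subset)
  qed
  then have "rank r ` S = {1..card S}"
    using inj by (intro card_subset_eq) (auto simp: card_image)
  with inj show ?thesis
    by (simp add: bij_betw_def)
qed

lemma
  assumes "(S, r) \<in> finite_chains"
  shows rank_in: "a \<in> S \<Longrightarrow> rank r a \<in> {1..card S}"
    and enum_in: "i \<in> {1..card S} \<Longrightarrow> enum (S, r) i \<in> S"
    and enum_rank: "a \<in> S \<Longrightarrow> enum (S, r) (rank r a) = a"
    and rank_enum: "i \<in> {1..card S} \<Longrightarrow> rank r (enum (S, r) i) = i"
    and enum_le_iff: "i \<in> {1..card S} \<Longrightarrow> j \<in> {1..card S} \<Longrightarrow>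
      (enum (S, r) i, enum (S, r) j) \<in> r \<longleftrightarrow> i \<le> j"
    and chain_le_iff: "a \<in> S \<Longrightarrow> b \<in> S \<Longrightarrow> (a, b) \<in> r \<longleftrightarrow> rank r a \<le> rank r b"
    and chain_less: "(a, b) \<in> r \<Longrightarrow> a \<noteq> b \<Longrightarrow> rank r a < rank r b"
    and card_chain: "1 \<le> card S"
proof -
  have S: "finite S" "linear_order_on S r" "S \<noteq> {}"
    using assms by (auto simp: finite_chains_def)
  note bij = bij_betw_rank[OF S(1,2)]
  show rank: "a \<in> S \<Longrightarrow> rank r a \<in> {1..card S}" for a
    using bij by (auto simp: bij_betw_def)
  show enum: "i \<in> {1..card S} \<Longrightarrow> enum (S, r) i \<in> S" for i
    using bij by (auto simp: bij_betw_def enum_def intro: inv_into_into)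
  show "a \<in> S \<Longrightarrow> enum (S, r) (rank r a) = a"
    using bij by (simp add: enum_def bij_betw_def)
  show re: "i \<in> {1..card S} \<Longrightarrow> rank r (enum (S, r) i) = i" for i
    using bij by (simp add: enum_def bij_betw_def f_inv_into_f)
  show le: "a \<in> S \<Longrightarrow> b \<in> S \<Longrightarrow> (a, b) \<in> r \<longleftrightarrow> rank r a \<le> rank r b" for a b
    using rank_le_iff[OF S(1,2)] by blast
  show "i \<in> {1..card S} \<Longrightarrow> j \<in> {1..card S} \<Longrightarrow> (enum (S, r) i, enum (S, r) j) \<in> r \<longleftrightarrow> i \<le> j"
    using le[OF enum enum] re by simp
  show "(a, b) \<in> r \<Longrightarrow> a \<noteq> b \<Longrightarrow> rank r a < rank r b"
    using rank_less[OF S(1,2)] .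
  show "1 \<le> card S"
    using S by (simp add: Suc_le_eq card_gt_0_iff)
qed

text \<open>The elements of chains come from an arbitrary infinite type. With \<open>e\<close>
  injective this transports \<open>{1..n}\<close>, and later finite sets of symbol codes, into that
  type.\<close>

definition nat_chain :: "(nat \<Rightarrow> 'c) \<Rightarrow> nat set \<Rightarrow> 'c chain" where
  "nat_chain e N = (e ` N, {(e i, e j) | i j. i \<in> N \<and> j \<in> N \<and> i \<le> j})"

lemma nat_chain_in:
  assumes "inj e" "finite N" "N \<noteq> {}"
  shows "nat_chain e N \<in> finite_chains"
  using assms(2,3) unfolding nat_chain_def finite_chains_def order_on_defs refl_on_def trans_def
    antisym_def total_on_def
  by (auto simp: inj_eq[OF assms(1)])

lemma nat_chain_le_iff:
  "inj e \<Longrightarrow> i \<in> N \<Longrightarrow> j \<in> N \<Longrightarrow> (e i, e j) \<in> snd (nat_chain e N) \<longleftrightarrow> i \<le> j"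
  by (auto simp: nat_chain_def dest: injD)

section \<open>Rigid surjections by their first occurrences\<close>

text \<open>The map \<open>p\<close> of first preimages replaces \<open>minim\<close>. Being a
  section of \<open>f\<close>, it forces \<open>f\<close> to be onto and \<open>p\<close> to be
  injective, so weak monotonicity of \<open>p\<close> suffices.\<close>

lemma rigid_surjectionsI:
  assumes P: "(S, r) \<in> finite_chains"
    and f: "f \<in> S \<rightarrow>\<^sub>E T"
    and p: "\<And>b. b \<in> T \<Longrightarrow> p b \<in> S" "\<And>b. b \<in> T \<Longrightarrow> f (p b) = b"
    and least: "\<And>i. i \<in> S \<Longrightarrow> (p (f i), i) \<in> r"
    and mono: "\<And>b b'. \<lbrakk>b \<in> T; b' \<in> T; (b, b') \<in> q; b \<noteq> b'\<rbrakk> \<Longrightarrow> (p b, p b') \<in> r"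
  shows "f \<in> rigid_surjections (S, r) (T, q)"
proof -
  have S: "finite S" "linear_order_on S r"
    using P by (auto simp: finite_chains_def)
  have minim: "wo_rel.minim r {i \<in> S. f i = b} = p b" if "b \<in> T" for b
    using that p least by (intro chain_minim_eqI[OF S]) auto
  have "f ` S = T"
    using f p by (force simp: image_iff)
  moreover have "p b \<noteq> p b'" if "b \<in> T" "b' \<in> T" "b \<noteq> b'" for b b'
    using p(2) that by metis
  ultimately show ?thesis
    using f mono minim by (simp add: rigid_surjections_def)
qed

lemma rigid_surjectionsE:
  assumes P: "(S, r) \<in> finite_chains" and f: "f \<in> rigid_surjections (S, r) (T, q)"
  obtains p where "f \<in> S \<rightarrow>\<^sub>E T" "\<And>b. b \<in> T \<Longrightarrow> p b \<in> S" "\<And>b. b \<in> T \<Longrightarrow> f (p b) = b"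
    "\<And>i. i \<in> S \<Longrightarrow> (p (f i), i) \<in> r"
    "\<And>b b'. \<lbrakk>b \<in> T; b' \<in> T; (b, b') \<in> q; b \<noteq> b'\<rbrakk> \<Longrightarrow> (p b, p b') \<in> r \<and> p b \<noteq> p b'"
proof -
  have S: "finite S" "linear_order_on S r"
    using P by (auto simp: finite_chains_def)
  define p where "p b = wo_rel.minim r {i \<in> S. f i = b}" for b
  have fE: "f \<in> S \<rightarrow>\<^sub>E T" "f ` S = T"
    and mono: "\<And>b b'. \<lbrakk>b \<in> T; b' \<in> T; (b, b') \<in> q; b \<noteq> b'\<rbrakk> \<Longrightarrow> (p b, p b') \<in> r \<and> p b \<noteq> p b'"
    using f by (auto simp: rigid_surjections_def p_def)
  have ne: "{i \<in> S. f i = b} \<noteq> {}" if "b \<in> T" for b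
    using fE that by auto
  note minim = chain_minim[OF S _ ne, folded p_def]
  show ?thesis
  proof (rule that)
    show "p b \<in> S" "f (p b) = b" if "b \<in> T" for b
      using minim(1)[of b] that by auto
    show "(p (f i), i) \<in> r" if "i \<in> S" for i
      using minim(2)[of "f i" i] that fE by auto
  qed (use fE mono in auto)
qed

context GR_setting
begin

section \<open>From words to rigid surjections\<close>

text \<open>Letters share index 1 with \<open>x 1\<close>: rigid surjections send least element to
  least element, so this choice is compatible with composing afterwards.\<close>

definition var_index :: "'a \<times> 'g \<Rightarrow> nat" where
  "var_index s = (if fst s \<in> A then 1 else inv_into {1..} x (fst s))"

lemma var_index_simps [simp]:
  "a \<in> A \<Longrightarrow> var_index (a, g) = 1"
  "1 \<le> l \<Longrightarrow> var_index (x l, g) = l"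
  by (simp_all add: var_index_def)

text \<open>This is \<open>\<Phi>\<close> of the first pre-adjunction: \<open>the_inv e\<close>
  recovers a position of the word, and \<open>enum P\<close> turns the index found there into an
  element of the chain.\<close>

definition word_surj :: "(nat \<Rightarrow> 'c) \<Rightarrow> 'c chain \<Rightarrow> nat \<Rightarrow> (nat \<Rightarrow> 'a \<times> 'g) \<Rightarrow> 'c \<Rightarrow> 'c" where
  "word_surj e P n u = (\<lambda>c\<in>e ` {1..n}. enum P (var_index (u (the_inv e c))))"

lemma var_index_in:
  assumes "u \<in> words A x G n m" "i \<in> {1..n}" "1 \<le> m"
  shows "var_index (u i) \<in> {1..m}"
  using assms(1,2) by (cases rule: words_cases) (use assms(3) in auto)

text \<open>For an element of rank l > 1 the fibre consists of the positions carrying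
  \<open>x l\<close> with any decoration, so it starts at the first occurrence of
  \<open>x l\<close>, and these occurrences increase with l.\<close>

lemma word_surj_rigid:
  assumes e: "inj e" and P: "(S, r) \<in> finite_chains" and u: "u \<in> words A x G n (card S)"
  shows "word_surj e (S, r) n u \<in> rigid_surjections (nat_chain e {1..n}) (S, r)"
proof -
  let ?m = "card S"
  have m: "1 \<le> ?m"
    by (rule card_chain[OF P])
  define pu where "pu l = Min (occs G n u (x l))" for l
  note u1 = words_first[OF u, folded pu_def] and u2 = words_mono[OF u, folded pu_def]
  have n: "1 \<le> n"
    using u1(1)[of 1] m by auto
  \<comment> \<open>The fibre of the least element also contains the letters, so it always starts at position 1.\<close>
  define p where "p b = (if rank r b = 1 then 1 else pu (rank r b))" for b
  have p_in: "p b \<in> {1..n}" if "b \<in> S" for b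
    using u1(1) rank_in[OF P that] n by (auto simp: p_def)
  \<comment> \<open>A word starts with a letter or with \<open>x 1\<close>: any other variable at
    position 1 would have to be preceded by the first occurrence of \<open>x 1\<close>.\<close>
  have first: "var_index (u 1) = 1"
    using u n
  proof (cases rule: words_cases[where i = 1, consumes 1, case_names dom letter var])
    case (var l g)
    show ?thesis
    proof (rule ccontr)
      assume "var_index (u 1) \<noteq> 1"
      with var have l: "1 \<in> {1..?m}" "l \<in> {1..?m}" "1 < l" by auto
      have "pu l \<le> 1"
        using u1(3)[of l 1 g] var n by auto
      with u2[OF l] u1(1)[OF l(1)] show False by auto
    qed
  qed auto
  have vp: "var_index (u (p b)) = rank r b" if "b \<in> S" for b
    using first u1(2)[OF rank_in[OF P that]] rank_in[OF P that] by (auto simp: p_def)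
  have pair: "nat_chain e {1..n} = (e ` {1..n}, snd (nat_chain e {1..n}))"
    by (simp add: nat_chain_def)
  have ws: "word_surj e (S, r) n u (e i) = enum (S, r) (var_index (u i))" if "i \<in> {1..n}" for i
    using that e by (simp add: word_surj_def the_inv_f_f)
  note vi = var_index_in[OF u _ m]
  have "word_surj e (S, r) n u \<in> rigid_surjections (e ` {1..n}, snd (nat_chain e {1..n})) (S, r)"
  proof (rule rigid_surjectionsI[where p = "e \<circ> p"])
    show "(e ` {1..n}, snd (nat_chain e {1..n})) \<in> finite_chains"
      unfolding pair[symmetric] using n by (intro nat_chain_in[OF e]) auto
    show "word_surj e (S, r) n u \<in> e ` {1..n} \<rightarrow>\<^sub>E S"
      using enum_in[OF P vi] e by (auto simp: word_surj_def the_inv_f_f)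
    show "(e \<circ> p) b \<in> e ` {1..n}" if "b \<in> S" for b
      using p_in[OF that] by simp
    show "word_surj e (S, r) n u ((e \<circ> p) b) = b" if "b \<in> S" for b
      using ws[OF p_in] vp enum_rank[OF P] that by simp
    show "((e \<circ> p) (word_surj e (S, r) n u c), c) \<in> snd (nat_chain e {1..n})"
      if "c \<in> e ` {1..n}" for c
    proof -
      from that obtain i where i: "i \<in> {1..n}" "c = e i" by auto
      define b where "b = enum (S, r) (var_index (u i))"
      have b: "b \<in> S" "rank r b = var_index (u i)"
        using enum_in[OF P vi[OF i(1)]] rank_enum[OF P vi[OF i(1)]] by (auto simp: b_def)
      have "p b \<le> i"
        using u i(1)
      proof (cases rule: words_cases)
        case (letter a)
        then show ?thesis using b i by (simp add: p_def)
      next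
        case (var l g)
        then show ?thesis using b i u1(3)[OF var(1) i(1) var(3)] by (auto simp: p_def)
      qed
      then show ?thesis
        using nat_chain_le_iff[OF e p_in[OF b(1)] i(1)] ws[OF i(1)] i(2) by (simp add: b_def)
    qed
    show "((e \<circ> p) b, (e \<circ> p) b') \<in> snd (nat_chain e {1..n})"
      if "b \<in> S" "b' \<in> S" "(b, b') \<in> r" "b \<noteq> b'" for b b'
    proof -
      have "rank r b < rank r b'"
        using chain_less[OF P] that by blast
      then have "p b \<le> p b'"
        using u2[OF rank_in[OF P that(1)] rank_in[OF P that(2)]] rank_in[OF P that(1)] p_in[OF that(2)]
        by (auto simp: p_def)
      then show ?thesis
        using nat_chain_le_iff[OF e] p_in that by simp
    qed
  qed
  then show ?thesis
    unfolding pair[symmetric] .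
qed

section \<open>Rigid surjections as words without letters and decorations\<close>

definition surj_word :: "'c chain \<Rightarrow> 'c chain \<Rightarrow> ('c \<Rightarrow> 'c) \<Rightarrow> nat \<Rightarrow> 'a \<times> 'g" where
  "surj_word P Q f = (\<lambda>i\<in>{1..card (fst P)}. (x (rank (snd Q) (f (enum P i))), \<one>))"

text \<open>The first occurrence of \<open>x l\<close> is the rank of the first preimage of the l-th
  element of the target, so rigidity is the ordering of first occurrences. The remaining word
  conditions hold because every decoration is neutral.\<close>

lemma surj_word_closed:
  assumes P: "(S, r) \<in> finite_chains" and Q: "(T, q) \<in> finite_chains"
    and f: "f \<in> rigid_surjections (S, r) (T, q)"
  shows "surj_word (S, r) (T, q) f \<in> words A x G (card S) (card T)"
proof -
  obtain p where fE: "f \<in> S \<rightarrow>\<^sub>E T" and p: "\<And>b. b \<in> T \<Longrightarrow> p b \<in> S" "\<And>b. b \<in> T \<Longrightarrow> f (p b) = b"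
    and least: "\<And>i. i \<in> S \<Longrightarrow> (p (f i), i) \<in> r"
    and mono: "\<And>b b'. \<lbrakk>b \<in> T; b' \<in> T; (b, b') \<in> q; b \<noteq> b'\<rbrakk> \<Longrightarrow> (p b, p b') \<in> r \<and> p b \<noteq> p b'"
    using rigid_surjectionsE[OF P f] by blast
  have fe: "f (enum (S, r) i) \<in> T" if "i \<in> {1..card S}" for i
    using fE enum_in[OF P that] by auto
  have rp: "rank r (p (enum (T, q) l)) \<in> {1..card S}" if "l \<in> {1..card T}" for l
    using rank_in[OF P p(1)[OF enum_in[OF Q that]]] .
  show ?thesis
  proof (rule wordsI(1)[where p = "\<lambda>l. rank r (p (enum (T, q) l))"])
    show "surj_word (S, r) (T, q) f \<in> extensional {1..card S}"
      by (simp add: surj_word_def)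
    show "(\<exists>a\<in>A. surj_word (S, r) (T, q) f i = (a, \<one>)) \<or>
        (\<exists>l\<in>{1..card T}. \<exists>g\<in>carrier G. surj_word (S, r) (T, q) f i = (x l, g))"
      if "i \<in> {1..card S}" for i
      using that rank_in[OF Q fe[OF that]] by (auto simp: surj_word_def)
    show "rank r (p (enum (T, q) l)) \<in> {1..card S} \<and>
        surj_word (S, r) (T, q) f (rank r (p (enum (T, q) l))) = (x l, \<one>)"
      if "l \<in> {1..card T}" for l
      using rp[OF that] that p[OF enum_in[OF Q that]] rank_enum[OF Q that] enum_rank[OF P]
      by (auto simp: surj_word_def)
    show "rank r (p (enum (T, q) l)) \<le> i"
      if "l \<in> {1..card T}" "i \<in> {1..card S}" "surj_word (S, r) (T, q) f i = (x l, g)" for l i g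
    proof -
      have "rank q (f (enum (S, r) i)) = l"
        using that rank_in[OF Q fe[OF that(2)]] by (auto simp: surj_word_def)
      then have "enum (T, q) l = f (enum (S, r) i)"
        using enum_rank[OF Q fe[OF that(2)]] by simp
      then have "(p (enum (T, q) l), enum (S, r) i) \<in> r"
        using least[OF enum_in[OF P that(2)]] by simp
      then show ?thesis
        using chain_le_iff[OF P p(1)[OF enum_in[OF Q that(1)]] enum_in[OF P that(2)]]
          rank_enum[OF P that(2)] by simp
    qed
    show "rank r (p (enum (T, q) k)) < rank r (p (enum (T, q) l))"
      if "k \<in> {1..card T}" "l \<in> {1..card T}" "k < l" for k l
    proof -
      have "(enum (T, q) k, enum (T, q) l) \<in> q" "enum (T, q) k \<noteq> enum (T, q) l"
        using enum_le_iff[OF Q] rank_enum[OF Q] that by (auto, metis atLeastAtMost_iff less_irrefl)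
      then show ?thesis
        using mono[OF enum_in[OF Q that(1)] enum_in[OF Q that(2)]] chain_less[OF P] by blast
    qed
  qed
qed

lemma words_le:
  assumes "w \<in> words A x G n m"
  shows "m \<le> n"
proof -
  define p where "p l = Min (occs G n w (x l))" for l
  note w1 = words_first[OF assms, folded p_def] and w2 = words_mono[OF assms, folded p_def]
  have "inj_on p {1..m}"
    using w2 by (auto intro!: linorder_inj_onI' simp: less_le)
  moreover have "p ` {1..m} \<subseteq> {1..n}"
    using w1(1) by auto
  ultimately show ?thesis
    using card_inj_on_le[of p "{1..m}" "{1..n}"] by simp
qed

lemma Hom_GR [simp]: "Hom (GR A x G act) m n = words A x G n m"
  using words_le by (auto simp: GR_def)

lemma Ob_GR [simp]: "Ob (GR A x G act) = {1..}"
  and Comp_GR [simp]: "Comp (GR A x G act) k m n = subst_word A x G act n"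
  by (auto simp: GR_def)

text \<open>This is (PA) with \<open>surj_word\<close> as \<open>v\<close>. Substituting it changes
  the index of a variable as \<open>f\<close> does and keeps the decoration, which is forgotten
  anyway; letters stay letters, which agrees with \<open>f\<close> because \<open>f\<close>
  preserves the least element.\<close>

lemma compose_word_surj:
  assumes e: "inj e" and P: "(S, r) \<in> finite_chains" and Q: "(T, q) \<in> finite_chains"
    and f: "f \<in> rigid_surjections (S, r) (T, q)" and u: "u \<in> words A x G n (card S)"
  shows "compose (e ` {1..n}) f (word_surj e (S, r) n u)
       = word_surj e (T, q) n (subst_word A x G act n u (surj_word (S, r) (T, q) f))"
proof -
  obtain p where fE: "f \<in> S \<rightarrow>\<^sub>E T" and p: "\<And>b. b \<in> T \<Longrightarrow> p b \<in> S" "\<And>b. b \<in> T \<Longrightarrow> f (p b) = b"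
    and least: "\<And>i. i \<in> S \<Longrightarrow> (p (f i), i) \<in> r"
    and mono: "\<And>b b'. \<lbrakk>b \<in> T; b' \<in> T; (b, b') \<in> q; b \<noteq> b'\<rbrakk> \<Longrightarrow> (p b, p b') \<in> r \<and> p b \<noteq> p b'"
    using rigid_surjectionsE[OF P f] by blast
  note v = surj_word_closed[OF P Q f]
  have S1: "1 \<in> {1..card S}" and T1: "1 \<in> {1..card T}"
    using card_chain[OF P] card_chain[OF Q] by auto
  \<comment> \<open>Otherwise the least element of the target would first be hit strictly before
    \<open>f ?a\<close> is, hence before the least element \<open>?a\<close> of the source.\<close>
  have f1: "f (enum (S, r) 1) = enum (T, q) 1"
  proof (rule ccontr)
    let ?a = "enum (S, r) 1" and ?b = "enum (T, q) 1"
    assume ne: "f ?a \<noteq> ?b"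
    have a: "?a \<in> S" "f ?a \<in> T" and b: "?b \<in> T"
      using enum_in[OF P S1] enum_in[OF Q T1] fE by auto
    have "(?b, f ?a) \<in> q"
      using chain_le_iff[OF Q b a(2)] rank_enum[OF Q T1] rank_in[OF Q a(2)] by simp
    then have "(p ?b, p (f ?a)) \<in> r" "p ?b \<noteq> p (f ?a)"
      using mono a b ne by auto
    then have "rank r (p ?b) < rank r (p (f ?a))"
      using chain_less[OF P] by blast
    also have "\<dots> \<le> rank r ?a"
      using least[OF a(1)] chain_le_iff[OF P] p a by blast
    also have "\<dots> = 1"
      by (rule rank_enum[OF P S1])
    finally show False
      using rank_in[OF P p(1)[OF b]] by simp
  qed
  have "f (enum (S, r) (var_index (u i)))
      = enum (T, q) (var_index (subst_word A x G act n u (surj_word (S, r) (T, q) f) i))"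
    if i: "i \<in> {1..n}" for i
    using u i
  proof (cases rule: words_cases)
    case (letter a)
    then show ?thesis
      using f1 subst_word_letter[OF i] by simp
  next
    case (var l g)
    have T: "f (enum (S, r) l) \<in> T"
      using enum_in[OF P var(1)] fE by auto
    have "subst_word A x G act n u (surj_word (S, r) (T, q) f) i
        = decorate A G act (surj_word (S, r) (T, q) f l) g"
      using var by (intro subst_word_var[OF i]) auto
    also have "\<dots> = (x (rank q (f (enum (S, r) l))), g)"
      using var rank_in[OF Q T] by (simp add: surj_word_def decorate_def)
    finally show ?thesis
      using var rank_in[OF Q T] enum_rank[OF Q T] by simp
  qed
  then show ?thesis
    using e by (auto simp: compose_def word_surj_def fun_eq_iff the_inv_f_f)
qed

section \<open>The first pre-adjunction: chains go to their sizes\<close>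

lemma DRam_le_GR:
  assumes "infinite (UNIV :: 'c set)"
  shows "Op (DRam :: ('c chain, 'c \<Rightarrow> 'c) cat) \<preceq>\<^sub>T GR A x G act"
proof -
  obtain e :: "nat \<Rightarrow> 'c" where e: "inj e"
    using assms infinite_countable_subset by blast
  let ?D = "DRam :: ('c chain, 'c \<Rightarrow> 'c) cat"
  have "pre_adjunction (Op ?D) (GR A x G act) (\<lambda>P. card (fst P)) (\<lambda>n. nat_chain e {1..n})"
  proof (intro pre_adjunction.intro pre_adjunction_axioms.intro category_Op category_DRam category_GR)
    show "(\<lambda>P. card (fst P)) \<in> Ob (Op ?D) \<rightarrow> Ob (GR A x G act)"
      using card_chain by (auto simp: Op_def DRam_def)
    show "(\<lambda>n. nat_chain e {1..n}) \<in> Ob (GR A x G act) \<rightarrow> Ob (Op ?D)"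
      using nat_chain_in[OF e] by (auto simp: Op_def DRam_def)
    show "\<exists>\<Phi>. (\<forall>P\<in>Ob (Op ?D). \<forall>n\<in>Ob (GR A x G act).
          \<Phi> P n \<in> Hom (GR A x G act) (card (fst P)) n \<rightarrow> Hom (Op ?D) P (nat_chain e {1..n})) \<and>
        (\<forall>n\<in>Ob (GR A x G act). \<forall>Q\<in>Ob (Op ?D). \<forall>P\<in>Ob (Op ?D).
          \<forall>u\<in>Hom (GR A x G act) (card (fst P)) n. \<forall>f\<in>Hom (Op ?D) Q P.
          \<exists>v\<in>Hom (GR A x G act) (card (fst Q)) (card (fst P)).
            Comp (Op ?D) Q P (nat_chain e {1..n}) (\<Phi> P n u) f
          = \<Phi> Q n (Comp (GR A x G act) (card (fst Q)) (card (fst P)) n u v))"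
    proof (intro exI[of _ "word_surj e"] conjI ballI funcsetI)
      fix P n u assume "P \<in> Ob (Op ?D)" "u \<in> Hom (GR A x G act) (card (fst P)) n"
      then show "word_surj e P n u \<in> Hom (Op ?D) P (nat_chain e {1..n})"
        using word_surj_rigid[OF e, of "fst P" "snd P"] by (simp add: Op_def DRam_def)
    next
      fix n P Q u f
      assume "Q \<in> Ob (Op ?D)" "P \<in> Ob (Op ?D)"
        and "u \<in> Hom (GR A x G act) (card (fst P)) n" "f \<in> Hom (Op ?D) Q P"
      \<comment> \<open>In the opposite category \<open>f\<close> is a rigid surjection from
        \<open>P\<close> onto \<open>Q\<close>, so its word has \<open>card (fst P)\<close>
        positions and \<open>card (fst Q)\<close> variables, as \<open>v\<close> must.\<close>
      then show "\<exists>v\<in>Hom (GR A x G act) (card (fst Q)) (card (fst P)).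
            Comp (Op ?D) Q P (nat_chain e {1..n}) (word_surj e P n u) f
          = word_surj e Q n (Comp (GR A x G act) (card (fst Q)) (card (fst P)) n u v)"
        using compose_word_surj[OF e, of "fst P" "snd P" "fst Q" "snd Q" f u n]
          surj_word_closed[of "fst P" "snd P" "fst Q" "snd Q" f]
        by (intro bexI[of _ "surj_word P Q f"])
          (simp_all add: Op_def DRam_def nat_chain_def)
    qed
  qed
  then show ?thesis
    by (auto simp: tukey_le_def)
qed

section \<open>From rigid surjections to words\<close>

text \<open>These are the values that a word over \<open>m\<close> variables may take. Each variable
  comes with every decoration, so a surjection onto the symbols uses all of them.\<close>

definition symbols :: "nat \<Rightarrow> ('a \<times> 'g) set" where
  "symbols m = A \<times> {\<one>} \<union> x ` {1..m} \<times> carrier G"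

lemma symbols_cases:
  assumes "s \<in> symbols m"
  obtains (letter) a where "a \<in> A" "s = (a, \<one>)"
  | (var) l g where "l \<in> {1..m}" "g \<in> carrier G" "s = (x l, g)"
  using assms unfolding symbols_def by blast

lemma symbols_intros:
  "a \<in> A \<Longrightarrow> (a, \<one>) \<in> symbols m"
  "l \<in> {1..m} \<Longrightarrow> g \<in> carrier G \<Longrightarrow> (x l, g) \<in> symbols m"
  by (auto simp: symbols_def)

text \<open>A common domain for all \<open>m\<close>, so that one code and one decoder serve every
  symbol chain.\<close>

definition all_symbols :: "('a \<times> 'g) set" where
  "all_symbols = (\<Union>m. symbols m)"

lemma symbols_subset: "symbols m \<subseteq> all_symbols"
  by (auto simp: all_symbols_def)

text \<open>Substitution acts on each position separately. Isolating its action on symbols lets it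
  become a morphism between symbol chains.\<close>

definition subst_symbol :: "(nat \<Rightarrow> 'a \<times> 'g) \<Rightarrow> 'a \<times> 'g \<Rightarrow> 'a \<times> 'g" where
  "subst_symbol v s = (case s of (y, h) \<Rightarrow>
     if y \<in> A then (y, h) else decorate A G act (v (inv_into {1..} x y)) h)"

lemma subst_symbol_simps:
  "a \<in> A \<Longrightarrow> subst_symbol v (a, g) = (a, g)"
  "1 \<le> l \<Longrightarrow> subst_symbol v (x l, g) = decorate A G act (v l) g"
  by (simp_all add: subst_symbol_def)

lemma subst_word_eq: "subst_word A x G act n u v = (\<lambda>i\<in>{1..n}. subst_symbol v (u i))"
  unfolding subst_word_def subst_symbol_def ..

lemma subst_symbol_in:
  assumes f: "f \<in> words A x G n m" and s: "s \<in> symbols n"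
  shows "subst_symbol f s \<in> symbols m"
  using s
proof (cases rule: symbols_cases)
  case (letter a)
  then show ?thesis by (simp add: subst_symbol_simps symbols_intros)
next
  case s: (var j h)
  from f s(1) show ?thesis
    by (cases rule: words_cases)
      (use s in \<open>auto simp: subst_symbol_simps decorate_def intro: symbols_intros\<close>)
qed

end

text \<open>The code carries the order on symbols. \<open>code_one\<close> and
  \<open>code_less\<close> make first occurrences undecorated and increasing;
  \<open>code_letter\<close>, \<open>code_less\<close> and \<open>code_shift\<close> make
  substitution rigid, the last one by ordering the decorations alike at every variable.\<close>

locale GR_coded = GR_setting A x G act
  for A :: "'a set" and x :: "nat \<Rightarrow> 'a" and G :: "('g, 'z) monoid_scheme" (structure)
    and act :: "'a \<Rightarrow> 'g \<Rightarrow> 'a" +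
  fixes code :: "'a \<times> 'g \<Rightarrow> nat" and e :: "nat \<Rightarrow> 'c"
  assumes finite_A: "finite A" and finite_G: "finite (carrier G)"
    and inj_code: "inj_on code all_symbols" and inj_e: "inj e"
    and code_letter: "\<And>a l g. a \<in> A \<Longrightarrow> 1 \<le> l \<Longrightarrow> g \<in> carrier G \<Longrightarrow> code (a, \<one>) \<le> code (x l, g)"
    and code_one: "\<And>l g. 1 \<le> l \<Longrightarrow> g \<in> carrier G \<Longrightarrow> code (x l, \<one>) \<le> code (x l, g)"
    and code_less: "\<And>k l g h. 1 \<le> k \<Longrightarrow> k < l \<Longrightarrow> g \<in> carrier G \<Longrightarrow> h \<in> carrier G \<Longrightarrow>
      code (x k, g) < code (x l, h)"
    and code_shift: "\<And>k l g h. 1 \<le> k \<Longrightarrow> 1 \<le> l \<Longrightarrow> code (x k, g) \<le> code (x k, h) \<Longrightarrow>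
      code (x l, g) \<le> code (x l, h)"
begin

section \<open>Symbol chains and the words read off from them\<close>

definition symbol_chain :: "nat \<Rightarrow> 'c chain" where
  "symbol_chain m = nat_chain e (code ` symbols m)"

abbreviation enc :: "'a \<times> 'g \<Rightarrow> 'c" where
  "enc s \<equiv> e (code s)"

abbreviation dec :: "'c \<Rightarrow> 'a \<times> 'g" where
  "dec \<equiv> inv_into all_symbols (\<lambda>s. enc s)"

lemma dec_enc: "s \<in> symbols m \<Longrightarrow> dec (enc s) = s"
proof -
  have "inj_on (\<lambda>s. enc s) all_symbols"
    using inj_code inj_e by (auto simp: inj_on_def)
  then show "s \<in> symbols m \<Longrightarrow> dec (enc s) = s"
    using symbols_subset by (intro inv_into_f_f) auto
qed

lemma fst_symbol_chain: "fst (symbol_chain m) = enc ` symbols m"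
  by (auto simp: symbol_chain_def nat_chain_def)

lemma symbol_chain_eq: "symbol_chain m = (enc ` symbols m, snd (symbol_chain m))"
  by (simp flip: fst_symbol_chain)

lemma symbol_chain_in: "1 \<le> m \<Longrightarrow> symbol_chain m \<in> finite_chains"
proof -
  assume "1 \<le> m"
  then have "(x 1, \<one>) \<in> symbols m"
    by (auto intro: symbols_intros)
  moreover have "finite (symbols m)"
    using finite_A finite_G by (simp add: symbols_def)
  ultimately show ?thesis
    unfolding symbol_chain_def by (intro nat_chain_in[OF inj_e]) auto
qed

lemma symbol_chain_le_iff:
  "s \<in> symbols m \<Longrightarrow> t \<in> symbols m \<Longrightarrow>
    (enc s, enc t) \<in> snd (symbol_chain m) \<longleftrightarrow> code s \<le> code t"
  unfolding symbol_chain_def by (intro nat_chain_le_iff[OF inj_e]) auto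

definition read_word :: "'c chain \<Rightarrow> ('c \<Rightarrow> 'c) \<Rightarrow> nat \<Rightarrow> 'a \<times> 'g" where
  "read_word P u = (\<lambda>i\<in>{1..card (fst P)}. dec (u (enum P i)))"

text \<open>Every symbol \<open>s\<close> occurs, first at position \<open>pos s\<close>, and
  \<open>pos\<close> increases with the code. So the neutral copy of \<open>x l\<close> comes before
  its other decorations and is the first occurrence of \<open>x l\<close>.\<close>

lemma read_word_closed:
  assumes P: "(S, r) \<in> finite_chains" and u: "u \<in> rigid_surjections (S, r) (symbol_chain m)"
  shows "read_word (S, r) u \<in> words A x G (card S) m"
proof -
  have u': "u \<in> rigid_surjections (S, r) (enc ` symbols m, snd (symbol_chain m))"
    using u by (simp flip: symbol_chain_eq)
  obtain p where uE: "u \<in> S \<rightarrow>\<^sub>E enc ` symbols m"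
    and p: "\<And>b. b \<in> enc ` symbols m \<Longrightarrow> p b \<in> S" "\<And>b. b \<in> enc ` symbols m \<Longrightarrow> u (p b) = b"
    and least: "\<And>i. i \<in> S \<Longrightarrow> (p (u i), i) \<in> r"
    and mono: "\<And>b b'. \<lbrakk>b \<in> enc ` symbols m; b' \<in> enc ` symbols m;
      (b, b') \<in> snd (symbol_chain m); b \<noteq> b'\<rbrakk> \<Longrightarrow> (p b, p b') \<in> r \<and> p b \<noteq> p b'"
    using rigid_surjectionsE[OF P u'] by blast
  define pos where "pos s = rank r (p (enc s))" for s
  have pos_in: "pos s \<in> {1..card S}" if "s \<in> symbols m" for s
    unfolding pos_def using that by (intro rank_in[OF P p(1)]) auto
  have sym: "read_word (S, r) u i \<in> symbols m" "u (enum (S, r) i) = enc (read_word (S, r) u i)"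
    if i: "i \<in> {1..card S}" for i
  proof -
    obtain s where "s \<in> symbols m" "u (enum (S, r) i) = enc s"
      using uE enum_in[OF P i] by blast
    then show "read_word (S, r) u i \<in> symbols m" "u (enum (S, r) i) = enc (read_word (S, r) u i)"
      using i dec_enc by (auto simp: read_word_def)
  qed
  have pos_read: "read_word (S, r) u (pos s) = s" if "s \<in> symbols m" for s
    using pos_in[OF that] that p enum_rank[OF P] dec_enc
    by (auto simp: read_word_def pos_def)
  have pos_le: "pos (read_word (S, r) u i) \<le> i" if i: "i \<in> {1..card S}" for i
  proof -
    let ?s = "read_word (S, r) u i"
    have "(p (enc ?s), enum (S, r) i) \<in> r"
      using least[OF enum_in[OF P i]] sym[OF i] by simp
    then show ?thesis
      using chain_le_iff[OF P p(1) enum_in[OF P i], of "enc ?s"] sym[OF i] rank_enum[OF P i]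
      by (simp add: pos_def)
  qed
  have pos_mono: "pos s < pos t" if "s \<in> symbols m" "t \<in> symbols m" "code s < code t" for s t
  proof -
    have "enc s \<noteq> enc t" "(enc s, enc t) \<in> snd (symbol_chain m)"
      using that symbol_chain_le_iff inj_e by (auto dest: injD)
    then show ?thesis
      unfolding pos_def using mono that chain_less[OF P] by blast
  qed
  show ?thesis
  proof (rule wordsI(1)[where p = "\<lambda>l. pos (x l, \<one>)"])
    show "read_word (S, r) u \<in> extensional {1..card S}"
      by (simp add: read_word_def)
    show "(\<exists>a\<in>A. read_word (S, r) u i = (a, \<one>)) \<or>
        (\<exists>l\<in>{1..m}. \<exists>g\<in>carrier G. read_word (S, r) u i = (x l, g))"
      if "i \<in> {1..card S}" for i
      using sym(1)[OF that] by (cases rule: symbols_cases) auto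
    show "pos (x l, \<one>) \<in> {1..card S} \<and> read_word (S, r) u (pos (x l, \<one>)) = (x l, \<one>)"
      if "l \<in> {1..m}" for l
      using that pos_in pos_read by (simp add: symbols_intros)
    show "pos (x l, \<one>) \<le> i"
      if l: "l \<in> {1..m}" and i: "i \<in> {1..card S}" and w: "read_word (S, r) u i = (x l, g)" for l i g
    proof -
      have s: "(x l, g) \<in> symbols m"
        using sym(1)[OF i] w by simp
      then have g: "g \<in> carrier G"
        using l by (auto simp: symbols_def)
      have "pos (x l, \<one>) \<le> pos (x l, g)"
      proof (cases "g = \<one>")
        case False
        have "code (x l, \<one>) \<noteq> code (x l, g)"
          using inj_code False s symbols_intros(2)[OF l one_closed] symbols_subset[of m]
          by (auto dest!: inj_onD)
        then have "code (x l, \<one>) < code (x l, g)"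
          using code_one[of l g] l g by simp
        then show ?thesis
          using pos_mono[OF symbols_intros(2)[OF l one_closed] s] by simp
      qed simp
      also have "\<dots> \<le> i"
        using pos_le[OF i] w by simp
      finally show ?thesis .
    qed
    show "pos (x k, \<one>) < pos (x l, \<one>)" if "k \<in> {1..m}" "l \<in> {1..m}" "k < l" for k l
      using that by (intro pos_mono symbols_intros code_less) auto
  qed
qed

section \<open>Substitution as a rigid surjection of symbol chains\<close>

definition subst_surj :: "nat \<Rightarrow> (nat \<Rightarrow> 'a \<times> 'g) \<Rightarrow> 'c \<Rightarrow> 'c" where
  "subst_surj n f = (\<lambda>c\<in>enc ` symbols n. enc (subst_symbol f (dec c)))"

lemma subst_surj_enc: "s \<in> symbols n \<Longrightarrow> subst_surj n f (enc s) = enc (subst_symbol f s)"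
  by (simp add: subst_surj_def dec_enc)

text \<open>A word in \<open>n\<close> positions and \<open>m\<close> variables replaces the
  \<open>n\<close> variables by symbols over \<open>m\<close>, so it maps the larger chain onto the
  smaller one, as a morphism of the opposite category from \<open>m\<close> to \<open>n\<close>
  should.\<close>

lemma subst_surj_rigid:
  assumes f: "f \<in> words A x G n m" and n: "1 \<le> n"
  shows "subst_surj n f \<in> rigid_surjections (symbol_chain n) (symbol_chain m)"
proof -
  define pf where "pf l = Min (occs G n f (x l))" for l
  note f1 = words_first[OF f, folded pf_def] and f2 = words_mono[OF f, folded pf_def]
  \<comment> \<open>The first preimage of a symbol: letters are fixed, and \<open>x\<^sub>l\<^sup>g\<close> first arises from \<open>x\<^sub>j\<^sup>g\<close>
    for the first occurrence \<open>j\<close> of \<open>x\<^sub>l\<close> in \<open>f\<close>, which is undecorated.\<close>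
  define p where "p s = (if fst s \<in> A then s else (x (pf (inv_into {1..} x (fst s))), snd s))"
    for s :: "'a \<times> 'g"
  have p_letter: "p (a, g) = (a, g)" if "a \<in> A" for a g
    using that by (simp add: p_def)
  have p_var: "p (x l, g) = (x (pf l), g)" if "1 \<le> l" for l g
    using that by (simp add: p_def)
  have p_in: "p s \<in> symbols n" if "s \<in> symbols m" for s
    using that
    by (cases rule: symbols_cases) (use f1(1) in \<open>auto simp: p_letter p_var intro!: symbols_intros\<close>)
  have p_subst: "subst_symbol f (p s) = s" if "s \<in> symbols m" for s
    using that
  proof (cases rule: symbols_cases)
    case (letter a)
    then show ?thesis by (simp add: p_letter subst_symbol_simps)
  next
    case (var l g)
    then show ?thesis
      using f1(1,2)[OF var(1)] by (simp add: p_var subst_symbol_simps decorate_def)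
  qed
  \<comment> \<open>A letter precedes any variable that is turned into it. If position j of
    \<open>f\<close> carries \<open>x l\<close>, then either j is the first occurrence, where
    \<open>f\<close> has the neutral decoration and \<open>s\<close> is its own first preimage, or j
    is later and \<open>code_less\<close> applies whatever the decorations are.\<close>
  have p_least: "code (p (subst_symbol f s)) \<le> code s" if s: "s \<in> symbols n" for s
    using s
  proof (cases rule: symbols_cases)
    case (letter a)
    then show ?thesis by (simp add: p_letter subst_symbol_simps)
  next
    case s: (var j h)
    from f s(1) show ?thesis
    proof (cases rule: words_cases)
      case (letter a)
      then show ?thesis
        using s code_letter by (simp add: subst_symbol_simps decorate_def p_letter)
    next
      case (var l g)
      have eq: "p (subst_symbol f s) = (x (pf l), g \<otimes> h)"
        using s var by (simp add: subst_symbol_simps decorate_def p_var)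
      have le: "pf l \<le> j"
        using f1(3)[OF var(1) s(1) var(3)] .
      show ?thesis
      proof (cases "pf l = j")
        case True
        then have "g = \<one>"
          using f1(2)[OF var(1)] var(3) by simp
        then show ?thesis
          using True eq s by simp
      next
        case False
        then show ?thesis
          using code_less[of "pf l" j "g \<otimes> h" h] le f1(1)[OF var(1)] s var eq by simp
      qed
    qed
  qed
  \<comment> \<open>Different variables keep their order by \<open>f2\<close>, and two decorations
    of one variable by \<open>code_shift\<close>. A variable before a letter, or indices in the
    wrong order, contradict \<open>less\<close>.\<close>
  have p_mono: "code (p s) \<le> code (p t)"
    if s: "s \<in> symbols m" and t: "t \<in> symbols m" and less: "code s < code t" for s t
    using s
  proof (cases rule: symbols_cases)
    case s: (letter a)
    from t show ?thesis
    proof (cases rule: symbols_cases)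
      case (letter b)
      then show ?thesis using s less by (simp add: p_letter)
    next
      case (var l h)
      then show ?thesis using s f1(1)[OF var(1)] code_letter by (simp add: p_letter p_var)
    qed
  next
    case s: (var k g)
    from t show ?thesis
    proof (cases rule: symbols_cases)
      case (letter b)
      then show ?thesis using s less code_letter[of b k g] by simp
    next
      case t: (var l h)
      consider "k < l" | "k = l" | "l < k" by linarith
      then show ?thesis
      proof cases
        case 1
        then show ?thesis
          using f2[OF s(1) t(1)] f1(1)[OF s(1)] code_less[of "pf k" "pf l" g h] s t by (simp add: p_var)
      next
        case 2
        then show ?thesis
          using code_shift[of k "pf k" g h] f1(1)[OF s(1)] s t less by (simp add: p_var)
      next
        case 3
        then show ?thesis
          using code_less[of l k h g] s t less by simp
      qed
    qed
  qed
  have pair: "symbol_chain k = (enc ` symbols k, snd (symbol_chain k))" for k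
    by (rule symbol_chain_eq)
  note sub_in = subst_symbol_in[OF f]
  have "subst_surj n f \<in> rigid_surjections (enc ` symbols n, snd (symbol_chain n))
      (enc ` symbols m, snd (symbol_chain m))"
  proof (rule rigid_surjectionsI[where p = "\<lambda>c. enc (p (dec c))"])
    show "(enc ` symbols n, snd (symbol_chain n)) \<in> finite_chains"
      using symbol_chain_in[OF n] by (simp flip: pair)
    show "subst_surj n f \<in> enc ` symbols n \<rightarrow>\<^sub>E enc ` symbols m"
      using sub_in dec_enc by (auto simp: subst_surj_def)
    show "enc (p (dec b)) \<in> enc ` symbols n" if "b \<in> enc ` symbols m" for b
      using that p_in dec_enc by auto
    show "subst_surj n f (enc (p (dec b))) = b" if "b \<in> enc ` symbols m" for b
      using that p_in p_subst by (auto simp: dec_enc subst_surj_enc)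
    show "(enc (p (dec (subst_surj n f c))), c) \<in> snd (symbol_chain n)"
      if "c \<in> enc ` symbols n" for c
      using that p_least p_in[OF sub_in]
      by (auto simp: subst_surj_enc dec_enc[OF sub_in] symbol_chain_le_iff)
    show "(enc (p (dec b)), enc (p (dec b'))) \<in> snd (symbol_chain n)"
      if "b \<in> enc ` symbols m" "b' \<in> enc ` symbols m" "(b, b') \<in> snd (symbol_chain m)" "b \<noteq> b'"
      for b b'
    proof -
      from that obtain s t where st: "s \<in> symbols m" "b = enc s" "t \<in> symbols m" "b' = enc t"
        by blast
      then have "code s \<le> code t" "code s \<noteq> code t"
        using that(3,4) symbol_chain_le_iff by auto
      then show ?thesis
        using st p_mono p_in by (simp add: dec_enc symbol_chain_le_iff)
    qed
  qed
  then show ?thesis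
    by (simp flip: pair)
qed

text \<open>This is (PA) for the second pre-adjunction. It holds position by position, since
  \<open>subst_surj\<close> is \<open>subst_symbol\<close> conjugated by the encoding.\<close>

lemma subst_read_word:
  assumes P: "(S, r) \<in> finite_chains" and u: "u \<in> rigid_surjections (S, r) (symbol_chain n)"
    and f: "f \<in> words A x G n m"
  shows "subst_word A x G act (card S) (read_word (S, r) u) f
       = read_word (S, r) (compose S (subst_surj n f) u)"
proof -
  have uE: "u \<in> S \<rightarrow> enc ` symbols n"
    using u fst_symbol_chain[of n] by (auto simp: rigid_surjections_def split: prod.splits)
  have "subst_symbol f (dec (u (enum (S, r) i))) = dec (subst_surj n f (u (enum (S, r) i)))"
    if i: "i \<in> {1..card S}" for i
  proof -
    obtain s where "s \<in> symbols n" "u (enum (S, r) i) = enc s"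
      using uE enum_in[OF P i] by blast
    then show ?thesis
      using dec_enc[of s n] dec_enc[OF subst_symbol_in[OF f]] by (simp add: subst_surj_enc)
  qed
  then show ?thesis
    using enum_in[OF P] by (auto simp: subst_word_eq read_word_def compose_def fun_eq_iff)
qed

lemma GR_le_DRam: "GR A x G act \<preceq>\<^sub>T Op (DRam :: ('c chain, 'c \<Rightarrow> 'c) cat)"
proof -
  let ?D = "DRam :: ('c chain, 'c \<Rightarrow> 'c) cat"
  have "pre_adjunction (GR A x G act) (Op ?D) symbol_chain (\<lambda>P. card (fst P))"
  proof (intro pre_adjunction.intro pre_adjunction_axioms.intro category_Op category_DRam category_GR)
    show "(\<lambda>P. card (fst P)) \<in> Ob (Op ?D) \<rightarrow> Ob (GR A x G act)"
      using card_chain by (auto simp: Op_def DRam_def)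
    show "symbol_chain \<in> Ob (GR A x G act) \<rightarrow> Ob (Op ?D)"
      using symbol_chain_in by (auto simp: Op_def DRam_def)
    show "\<exists>\<Phi>. (\<forall>m\<in>Ob (GR A x G act). \<forall>P\<in>Ob (Op ?D).
          \<Phi> m P \<in> Hom (Op ?D) (symbol_chain m) P \<rightarrow> Hom (GR A x G act) m (card (fst P))) \<and>
        (\<forall>P\<in>Ob (Op ?D). \<forall>m\<in>Ob (GR A x G act). \<forall>n\<in>Ob (GR A x G act).
          \<forall>u\<in>Hom (Op ?D) (symbol_chain n) P. \<forall>f\<in>Hom (GR A x G act) m n.
          \<exists>v\<in>Hom (Op ?D) (symbol_chain m) (symbol_chain n).
            Comp (GR A x G act) m n (card (fst P)) (\<Phi> n P u) f
          = \<Phi> m P (Comp (Op ?D) (symbol_chain m) (symbol_chain n) P u v))"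
    proof (intro exI[of _ "\<lambda>_. read_word"] conjI ballI funcsetI)
      fix m P u assume "P \<in> Ob (Op ?D)" "u \<in> Hom (Op ?D) (symbol_chain m) P"
      then show "read_word P u \<in> Hom (GR A x G act) m (card (fst P))"
        using read_word_closed[of "fst P" "snd P" u m] by (simp add: Op_def DRam_def)
    next
      fix P m n u f
      assume "P \<in> Ob (Op ?D)" "n \<in> Ob (GR A x G act)"
        and "u \<in> Hom (Op ?D) (symbol_chain n) P" "f \<in> Hom (GR A x G act) m n"
      then show "\<exists>v\<in>Hom (Op ?D) (symbol_chain m) (symbol_chain n).
            Comp (GR A x G act) m n (card (fst P)) (read_word P u) f
          = read_word P (Comp (Op ?D) (symbol_chain m) (symbol_chain n) P u v)"
        using subst_read_word[of "fst P" "snd P" u n f m] subst_surj_rigid[of f n m]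
        by (intro bexI[of _ "subst_surj n f"]) (simp_all add: Op_def DRam_def)
    qed
  qed
  then show ?thesis
    by (auto simp: tukey_le_def)
qed

end

section \<open>Construction of the code, and the equivalence\<close>

lemma (in GR_setting) exists_GR_coded:
  fixes e :: "nat \<Rightarrow> 'c"
  assumes "finite A" "finite (carrier G)" "inj e"
  obtains code where "GR_coded A x G act code e"
proof -
  obtain \<alpha> K where \<alpha>: "\<alpha> ` A = {i::nat. i < K}" "inj_on \<alpha> A"
    using finite_imp_inj_to_nat_seg[OF assms(1)] by blast
  obtain \<gamma>' Q' where \<gamma>': "\<gamma>' ` carrier G = {i::nat. i < Q'}" "inj_on \<gamma>' (carrier G)"
    using finite_imp_inj_to_nat_seg[OF assms(2)] by blast
  \<comment> \<open>An arbitrary numbering of the group is shifted by one to free the value 0 for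
    the neutral element; hence the bound \<open>Suc Q'\<close>.\<close>
  define \<gamma> where "\<gamma> g = (if g = \<one> then 0 else Suc (\<gamma>' g))" for g
  define Q where "Q = Suc Q'"
  have \<alpha>_less: "\<alpha> a < K" if "a \<in> A" for a
    using \<alpha> that by blast
  have \<gamma>_less: "\<gamma> g < Q" if "g \<in> carrier G" for g
    using \<gamma>' that by (auto simp: \<gamma>_def Q_def)
  have \<gamma>_inj: "g = h" if "g \<in> carrier G" "h \<in> carrier G" "\<gamma> g = \<gamma> h" for g h
    using \<gamma>' that by (auto simp: \<gamma>_def inj_on_def split: if_splits)
  \<comment> \<open>Letters lie below K, and each variable owns a block of length Q in which
    \<gamma> orders its decorations. As \<gamma> stays below Q, the blocks do not overlap.\<close>
  define code where "code s = (if fst s \<in> A then \<alpha> (fst s)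
    else K + inv_into {1..} x (fst s) * Q + \<gamma> (snd s))" for s
  have code_a: "code (a, g) = \<alpha> a" if "a \<in> A" for a g
    using that by (simp add: code_def)
  have code_x: "code (x l, g) = K + l * Q + \<gamma> g" if "1 \<le> l" for l g
    using that by (simp add: code_def)
  have less: "code (x k, g) < code (x l, h)"
    if "1 \<le> k" "k < l" "g \<in> carrier G" "h \<in> carrier G" for k l g h
  proof -
    have "k * Q + \<gamma> g < Suc k * Q"
      using \<gamma>_less that by simp
    also have "\<dots> \<le> l * Q"
      using that by (intro mult_le_mono1) simp
    finally show ?thesis
      using that by (simp add: code_x)
  qed
  show ?thesis
  proof (rule that, unfold_locales)
    show "inj_on code all_symbols"
    proof (rule inj_onI)
      fix s t assume "s \<in> all_symbols" "t \<in> all_symbols" and eq: "code s = code t"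
      then obtain m n where s: "s \<in> symbols m" and t: "t \<in> symbols n"
        by (auto simp: all_symbols_def)
      show "s = t"
        using s
      proof (cases rule: symbols_cases)
        case s: (letter a)
        from t show ?thesis
        proof (cases rule: symbols_cases)
          case (letter b)
          then show ?thesis using s eq \<alpha>(2) by (auto simp: code_a dest: inj_onD)
        next
          case (var l g)
          then show ?thesis using s eq \<alpha>_less[of a] by (auto simp: code_a code_x)
        qed
      next
        case s: (var k g)
        from t show ?thesis
        proof (cases rule: symbols_cases)
          case (letter b)
          then show ?thesis using s eq \<alpha>_less[of b] by (auto simp: code_a code_x)
        next
          case (var l h)
          then have "k = l"
            using s eq less[of k l g h] less[of l k h g] by (metis atLeastAtMost_iff less_irrefl nat_neq_iff)
          then show ?thesis
            using s var eq \<gamma>_inj by (auto simp: code_x)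
        qed
      qed
    qed
    show "code (a, \<one>) \<le> code (x l, g)" if "a \<in> A" "1 \<le> l" for a l g
      using \<alpha>_less[OF that(1)] that by (simp add: code_a code_x)
    show "code (x l, \<one>) \<le> code (x l, g)" if "1 \<le> l" for l g
      using that by (simp add: code_x \<gamma>_def)
    show "code (x l, g) \<le> code (x l, h)" if "1 \<le> k" "1 \<le> l" "code (x k, g) \<le> code (x k, h)" for k l g h
      using that by (simp add: code_x)
  qed (use assms less in auto)
qed

theorem theorem5p4:
  fixes A :: "'a set" and x :: "nat \<Rightarrow> 'a"
    and G :: "('g, 'z) monoid_scheme" and act :: "'a \<Rightarrow> 'g \<Rightarrow> 'a"
  assumes "finite A"
    and "variables x A"
    and "group G" and "finite (carrier G)"
    and "right_action G A act"
    and "infinite (UNIV :: 'c set)"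
  shows "Op (DRam :: ('c chain, 'c \<Rightarrow> 'c) cat) \<equiv>\<^sub>T GR A x G act"
proof -
  interpret GR_setting A x G act
    using assms by (simp add: GR_setting_def GR_setting_axioms_def)
  obtain e :: "nat \<Rightarrow> 'c" where e: "inj e"
    using assms(6) infinite_countable_subset by blast
  obtain code where "GR_coded A x G act code e"
    using exists_GR_coded[OF assms(1,4) e] .
  then show ?thesis
    using DRam_le_GR[OF assms(6)] GR_coded.GR_le_DRam by (auto simp: tukey_equiv_def)
qed

end
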